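(* There exists a function $g:\mathbb{N}\to\mathbb{N}$ such that the following holds. For every instance of MinAvgSTC in which all jobs have unit weight ($w_j=1$ for all $j$), with $K$ scenarios and an arbitrary number $m$ of machines ($m$ part of the input), and for every fixed ordering of the jobs (the jobs being labelled $1,\dots,n$ according to this ordering), there exists an optimal assignment $\varphi$ for MinAvgSTC whose full disbalance \[ \max_{j\in[n],\,k\in[K]}\Big\{\max_{i\in[m]}|\{j'\in J_i\cap S_k: j'\le j\}|-\min_{i\in[m]}|\{j'\in J_i\cap S_k: j'\le j\}|\Big\} \] is at most $g(K)$.
   Context: An instance consists of jobs $[n]$, machines $[m]$, job weights $w_j$, and scenarios $S_1,\dots,S_K\subseteq[n]$. A solution is an assignment $\varphi:[n]\to[m]$; write $J_i=\varphi^{-1}(i)$. The cost of $\varphi$ in scenario $k$ is $G(\varphi,k)=\sum_{i=1}^m\sum_{j\in J_i\cap S_k} w_j\cdot|\{j'\in J_i\cap S_k: j'\le j\}|$; with unit weights this equals $\sum_{i=1}^m \tfrac12 |J_i\cap S_k|(|J_i\cap S_k|+1)$ and does not depend on the job order. MinAvgSTC asks to minimize $\sum_{k=1}^K G(\varphi,k)$. *)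

theory Defs
  imports Complex_Main "HOL-Library.FuncSet"
begin

text \<open>
  Jobs are \<open>{1..n}\<close>, machines \<open>{1..m}\<close>, and scenarios \<open>S k\<close> for \<open>k \<in> {1..K}\<close>.
  The labels of the jobs carry the job ordering: quantifying over all \<open>S\<close> quantifies over
  all orderings. At least one machine is required, so that assignments exist and the
  maximum and minimum over the machines are meaningful; \<open>n = 0\<close> and \<open>K = 0\<close> are allowed.
\<close>

definition stc_instance :: "nat \<Rightarrow> nat \<Rightarrow> nat \<Rightarrow> (nat \<Rightarrow> nat set) \<Rightarrow> bool" where
  "stc_instance n m K S \<longleftrightarrow> 1 \<le> m \<and> (\<forall>k\<in>{1..K}. S k \<subseteq> {1..n})"

definition assignments :: "nat \<Rightarrow> nat \<Rightarrow> (nat \<Rightarrow> nat) set" where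
  "assignments n m = {1..n} \<rightarrow>\<^sub>E {1..m}"

definition jobs_on :: "nat \<Rightarrow> (nat \<Rightarrow> nat) \<Rightarrow> nat \<Rightarrow> nat set" where
  "jobs_on n \<phi> i = {j \<in> {1..n}. \<phi> j = i}"

definition prefix_load ::
  "nat \<Rightarrow> (nat \<Rightarrow> nat set) \<Rightarrow> (nat \<Rightarrow> nat) \<Rightarrow> nat \<Rightarrow> nat \<Rightarrow> nat \<Rightarrow> nat" where
  "prefix_load n S \<phi> k i j = card {j' \<in> jobs_on n \<phi> i \<inter> S k. j' \<le> j}"

definition scenario_cost ::
  "nat \<Rightarrow> nat \<Rightarrow> (nat \<Rightarrow> real) \<Rightarrow> (nat \<Rightarrow> nat set) \<Rightarrow> (nat \<Rightarrow> nat) \<Rightarrow> nat \<Rightarrow> real" where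
  "scenario_cost n m w S \<phi> k =
     (\<Sum>i\<in>{1..m}. \<Sum>j\<in>jobs_on n \<phi> i \<inter> S k. w j * real (prefix_load n S \<phi> k i j))"

definition total_cost ::
  "nat \<Rightarrow> nat \<Rightarrow> nat \<Rightarrow> (nat \<Rightarrow> real) \<Rightarrow> (nat \<Rightarrow> nat set) \<Rightarrow> (nat \<Rightarrow> nat) \<Rightarrow> real" where
  "total_cost n m K w S \<phi> = (\<Sum>k\<in>{1..K}. scenario_cost n m w S \<phi> k)"

definition MinAvgSTC_optimal ::
  "nat \<Rightarrow> nat \<Rightarrow> nat \<Rightarrow> (nat \<Rightarrow> real) \<Rightarrow> (nat \<Rightarrow> nat set) \<Rightarrow> (nat \<Rightarrow> nat) \<Rightarrow> bool" where
  "MinAvgSTC_optimal n m K w S \<phi> \<longleftrightarrow>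
     \<phi> \<in> assignments n m \<and>
     (\<forall>\<psi>\<in>assignments n m. total_cost n m K w S \<phi> \<le> total_cost n m K w S \<psi>)"

text \<open>
  The truncated subtraction is exact for \<open>m \<ge> 1\<close>. The element \<open>0\<close> is inserted only to fix
  the value \<open>0\<close> when there are no jobs or no scenarios; otherwise it does not change
  the maximum.
\<close>

definition full_disbalance ::
  "nat \<Rightarrow> nat \<Rightarrow> nat \<Rightarrow> (nat \<Rightarrow> nat set) \<Rightarrow> (nat \<Rightarrow> nat) \<Rightarrow> nat" where
  "full_disbalance n m K S \<phi> =
     Max (insert 0 {Max {prefix_load n S \<phi> k i j | i. i \<in> {1..m}}
                    - Min {prefix_load n S \<phi> k i j | i. i \<in> {1..m}}
                   | j k. j \<in> {1..n} \<and> k \<in> {1..K}})"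

end

theory Submission
  imports Defs "HOL-Library.Infinite_Set"
begin

text \<open>
  The cost depends only on how many jobs of each type, a subset of the scenarios, every machine
  receives. Among the optimal assignments take one minimising the sum of the squares of these
  counts, and let \<open>d\<close> be the difference of the count vectors of two machines. Suppose that every
  coordinate of \<open>e\<close> equals that of \<open>d\<close> or lies strictly between it and \<open>0\<close>, and likewise for the
  scenario sums of \<open>e\<close> and \<open>d\<close>. Exchanging \<open>d - e\<close> turns the difference \<open>d\<close> into \<open>2 * e - d\<close>,
  which does not raise the cost and lowers the sum of squares unless \<open>e = d\<close>.
  So the differences that occur form an antichain in a well partial order that depends only
  on \<open>K\<close>, hence they are bounded in terms of \<open>K\<close>.
  Jobs of one type are interchangeable, and distributing them backwards in time, always to
  the machine with the largest remaining count, carries the bound over to all prefixes.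
\<close>

section \<open>Bounded antichains of integer vectors\<close>

text \<open>A partial order on the integers in which 0 is comparable only to itself. Placing 0 below
  a nonzero \<open>b\<close> would spoil the strict decrease under reflection, since
  \<open>2 * 0 - b\<close> has the same square as \<open>b\<close>.\<close>

definition between0 :: "int \<Rightarrow> int \<Rightarrow> bool" where
  "between0 a b \<longleftrightarrow> a = b \<or> (0 < a \<and> a < b) \<or> (b < a \<and> a < 0)"

text \<open>The mirror image of \<open>b\<close> in a point between 0 and \<open>b\<close> has
  absolute value at most that of \<open>b\<close>.\<close>

lemma between0_reflect_sq_le: "between0 a b \<Longrightarrow> (2 * a - b)\<^sup>2 \<le> b\<^sup>2"
  unfolding between0_def by (auto simp: abs_le_square_iff[symmetric])

lemma between0_reflect_sq_less: "between0 a b \<Longrightarrow> a \<noteq> b \<Longrightarrow> (2 * a - b)\<^sup>2 < b\<^sup>2"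
  unfolding between0_def by (simp only: not_le[symmetric] abs_le_square_iff[symmetric]) auto

lemma between0_minus: "between0 (- a) (- b) \<longleftrightarrow> between0 a b"
  unfolding between0_def by auto

text \<open>Infinitely many positive values are unbounded, even after discarding an initial segment,
  so positive terms of strictly increasing value can be picked one after another.\<close>

lemma int_seq_between0_subseq_pos:
  fixes s :: "nat \<Rightarrow> int"
  assumes inf: "infinite (range s \<inter> {0<..})"
  obtains f :: "nat \<Rightarrow> nat"
  where "strict_mono f" "\<And>i j. i < j \<Longrightarrow> between0 (s (f i)) (s (f j))"
proof -
  have next_ex: "\<exists>n>M. 0 < s n \<and> B < s n" for M :: nat and B :: int
  proof (rule ccontr)
    assume "\<not> ?thesis"
    then have "range s \<inter> {0<..} \<subseteq> s ` {..M} \<union> {0..B}"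
      by (force simp: not_less not_le)
    then show False using inf finite_subset by blast
  qed
  obtain f :: "nat \<Rightarrow> nat" where f: "\<And>i. 0 < s (f i)" "\<And>i. f i < f (Suc i) \<and> s (f i) < s (f (Suc i))"
    using dependent_nat_choice[of "\<lambda>_ n. 0 < s n" "\<lambda>_ n n'. n < n' \<and> s n < s n'"] next_ex by metis
  have "strict_mono f" "strict_mono (\<lambda>i. s (f i))"
    using f(2) by (simp_all add: strict_mono_Suc_iff)
  then show ?thesis
    using f(1) by (intro that[of f]) (auto simp: between0_def dest: strict_monoD)
qed

text \<open>Either one value recurs infinitely often and gives a constant subsequence, or infinitely
  many values share a sign; the negative case is the positive case for \<open>- s\<close>.\<close>

lemma int_seq_between0_subseq:
  fixes s :: "nat \<Rightarrow> int"
  obtains f :: "nat \<Rightarrow> nat"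
  where "strict_mono f" "\<And>i j. i < j \<Longrightarrow> between0 (s (f i)) (s (f j))"
proof (cases "finite (range s)")
  case True
  then obtain n0 where y: "infinite {x \<in> UNIV. s x = s n0}"
    using pigeonhole_infinite[of UNIV s] by (auto simp: infinite_UNIV_nat)
  define f where "f = enumerate {x. s x = s n0}"
  have "strict_mono f" "s (f i) = s n0" for i
    using y enumerate_in_set[of "{x. s x = s n0}"] unfolding f_def
    by (auto intro: strict_mono_enumerate)
  then show ?thesis by (intro that[of f]) (auto simp: between0_def)
next
  case False
  have "uminus ` (range s \<inter> {..<0}) = range (\<lambda>i. - s i) \<inter> {0<..}"
    by (auto simp: image_iff)
  then have eq: "finite (range s \<inter> {..<0}) \<longleftrightarrow> finite (range (\<lambda>i. - s i) \<inter> {0<..})"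
    by (metis finite_imageD finite_imageI inj_on_def neg_equal_iff_equal)
  have "range s \<subseteq> (range s \<inter> {0<..}) \<union> (range s \<inter> {..<0}) \<union> {0}"
    by auto
  with False have "infinite (range s \<inter> {0<..}) \<or> infinite (range s \<inter> {..<0})"
    by (meson finite.emptyI finite.insertI finite_UnI finite_subset)
  then show ?thesis
  proof
    assume "infinite (range s \<inter> {0<..})"
    then show ?thesis using int_seq_between0_subseq_pos that by blast
  next
    assume "infinite (range s \<inter> {..<0})"
    with eq have "infinite (range (\<lambda>i. - s i) \<inter> {0<..})" by blast
    from int_seq_between0_subseq_pos[OF this] that show ?thesis
      by (auto simp: between0_minus)
  qed
qed

text \<open>A statement in the spirit of Dickson's lemma: the relation survives passing to a further
  subsequence, so the sequences in \<open>F\<close> can be treated one at a time.\<close>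

lemma int_seqs_between0_subseq:
  fixes F :: "(nat \<Rightarrow> int) set"
  assumes "finite F"
  shows "\<exists>f :: nat \<Rightarrow> nat. strict_mono f \<and> (\<forall>s\<in>F. \<forall>i j. i < j \<longrightarrow> between0 (s (f i)) (s (f j)))"
  using assms
proof induction
  case empty
  then show ?case by (auto intro: exI[of _ id] simp: strict_mono_id)
next
  case (insert s F)
  then obtain f :: "nat \<Rightarrow> nat" where f: "strict_mono f"
    "\<And>s i j. s \<in> F \<Longrightarrow> i < j \<Longrightarrow> between0 (s (f i)) (s (f j))" by blast
  obtain g :: "nat \<Rightarrow> nat" where g: "strict_mono g" "\<And>i j. i < j \<Longrightarrow> between0 (s (f (g i))) (s (f (g j)))"
    using int_seq_between0_subseq[of "\<lambda>i. s (f i)"] by blast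
  have "between0 (r ((f \<circ> g) i)) (r ((f \<circ> g) j))" if "r \<in> insert s F" "i < j" for r i j
    using that f(2) g strict_monoD[OF g(1)] by auto
  then show ?case using strict_mono_o[OF f(1) g(1)] by blast
qed

section \<open>Minimal difference vectors and their bound\<close>

text \<open>Polymorphic because it is applied both to natural-number loads and to signed
  differences.\<close>

definition scenario_sum :: "nat \<Rightarrow> (nat set \<Rightarrow> 'a :: comm_monoid_add) \<Rightarrow> nat \<Rightarrow> 'a" where
  "scenario_sum K d k = (\<Sum>t\<in>{t \<in> Pow {1..K}. k \<in> t}. d t)"

text \<open>Minimality in the product order on type coordinates with the scenario sums appended as
  further coordinates.\<close>

definition irreducible_diff :: "nat \<Rightarrow> (nat set \<Rightarrow> int) \<Rightarrow> bool" where
  "irreducible_diff K d \<longleftrightarrow>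
     (\<forall>e. (\<forall>t\<in>Pow {1..K}. between0 (e t) (d t)) \<longrightarrow>
          (\<forall>k\<in>{1..K}. between0 (scenario_sum K e k) (scenario_sum K d k)) \<longrightarrow>
          (\<forall>t\<in>Pow {1..K}. e t = d t))"

text \<open>Unbounded irreducible vectors would contain a subsequence that is increasing in all
  coordinates and scenario sums; irreducibility of each later vector then makes it equal to the
  first, which contradicts the growth.\<close>

lemma irreducible_diff_bounded:
  "\<exists>D :: nat. \<forall>d. irreducible_diff K d \<longrightarrow> (\<forall>t\<in>Pow {1..K}. \<bar>d t\<bar> \<le> int D)"
proof (rule ccontr)
  assume "\<not> ?thesis"
  then have "\<forall>N :: nat. \<exists>d. irreducible_diff K d \<and> (\<exists>t\<in>Pow {1..K}. int N < \<bar>d t\<bar>)"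
    by (auto simp: not_le)
  then obtain d :: "nat \<Rightarrow> nat set \<Rightarrow> int" where d: "\<And>N. irreducible_diff K (d N)"
    "\<And>N. \<exists>t\<in>Pow {1..K}. int N < \<bar>d N t\<bar>" by metis
  define F where "F = (\<lambda>t N. d N t) ` Pow {1..K} \<union> (\<lambda>k N. scenario_sum K (d N) k) ` {1..K}"
  have "finite F" by (simp add: F_def)
  from int_seqs_between0_subseq[OF this] obtain f :: "nat \<Rightarrow> nat" where f: "strict_mono f"
    "\<And>s i j. s \<in> F \<Longrightarrow> i < j \<Longrightarrow> between0 (s (f i)) (s (f j))" by blast
  have const: "d (f 0) t = d (f j) t" if "0 < j" "t \<in> Pow {1..K}" for j t
  proof -
    have "between0 (d (f 0) t) (d (f j) t)" if "t \<in> Pow {1..K}" for t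
      using f(2)[of "\<lambda>N. d N t" 0 j] that \<open>0 < j\<close> by (auto simp: F_def)
    moreover have "between0 (scenario_sum K (d (f 0)) k) (scenario_sum K (d (f j)) k)"
      if "k \<in> {1..K}" for k
      using f(2)[of "\<lambda>N. scenario_sum K (d N) k" 0 j] that \<open>0 < j\<close> by (auto simp: F_def)
    ultimately show ?thesis
      using d(1)[of "f j"] that unfolding irreducible_diff_def by blast
  qed
  \<comment> \<open>The summand 1 makes the bound strict and gives \<open>0 < M\<close>, so
    \<open>const\<close> applies to index \<open>M\<close>, while some coordinate of
    \<open>d (f M)\<close> exceeds \<open>f M\<close>, which is at least \<open>M\<close>.\<close>
  define M where "M = nat (Max ((\<lambda>t. \<bar>d (f 0) t\<bar>) ` Pow {1..K})) + 1"
  have M: "\<bar>d (f 0) t\<bar> < int M" if "t \<in> Pow {1..K}" for t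
  proof -
    have "\<bar>d (f 0) t\<bar> \<le> Max ((\<lambda>t. \<bar>d (f 0) t\<bar>) ` Pow {1..K})"
      by (rule Max_ge) (use that in auto)
    then show ?thesis unfolding M_def by linarith
  qed
  obtain t where t: "t \<in> Pow {1..K}" "int (f M) < \<bar>d (f M) t\<bar>" using d(2) by blast
  have "M \<le> f M" using f(1) by (rule strict_mono_imp_increasing)
  moreover have "d (f 0) t = d (f M) t" using const[of M t] t(1) by (simp add: M_def)
  ultimately show False using M[OF t(1)] t(2) by linarith
qed

section \<open>Distributing the jobs of one type\<close>

text \<open>The last job goes to a fullest machine, so the remaining counts stay within \<open>D\<close>.\<close>

lemma balanced_distribution:
  fixes J :: "nat set" and c :: "nat \<Rightarrow> nat" and D :: nat
  assumes "finite J" "(\<Sum>a\<in>{1..m}. c a) = card J" "1 \<le> D"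
    "\<And>a b. a \<in> {1..m} \<Longrightarrow> b \<in> {1..m} \<Longrightarrow> c a \<le> c b + D"
  shows "\<exists>f. f ` J \<subseteq> {1..m} \<and> (\<forall>a\<in>{1..m}. card {j \<in> J. f j = a} = c a) \<and>
     (\<forall>x. \<forall>a\<in>{1..m}. \<forall>b\<in>{1..m}.
        card {j \<in> J. f j = a \<and> j \<le> x} \<le> card {j \<in> J. f j = b \<and> j \<le> x} + D)"
  using assms
proof (induction "card J" arbitrary: J c)
  case 0
  then show ?case by auto
next
  case (Suc n)
  define z where "z = Max J"
  define J' where "J' = J - {z}"
  have "J \<noteq> {}" using Suc.hyps(2) by auto
  then have z: "z \<in> J" "\<And>j. j \<in> J' \<Longrightarrow> j < z"
    using Suc.prems(1) Max_ge[of J] by (auto simp: z_def J'_def less_le)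
  have J: "J = insert z J'" "z \<notin> J'" "finite J'" using z Suc.prems(1) by (auto simp: J'_def)
  have cJ: "card J = Suc (card J')" using J by simp
  have ne: "{1..m} \<noteq> {}" using Suc.prems(2) cJ by (metis sum.empty nat.distinct(1))
  define y where "y = Max (c ` {1..m})"
  have "y \<in> c ` {1..m}" unfolding y_def using ne by (intro Max_in) auto
  then obtain i where i: "i \<in> {1..m}" "c i = y" by auto
  have imax: "c a \<le> c i" if "a \<in> {1..m}" for a
    unfolding i(2) y_def by (rule Max_ge) (use that in auto)
  have ipos: "0 < c i"
  proof (rule ccontr)
    assume "\<not> 0 < c i"
    with imax have "(\<Sum>a\<in>{1..m}. c a) = 0" by (intro sum.neutral) force
    then show False using Suc.prems(2) cJ by simp
  qed
  define c' where "c' = c(i := c i - 1)"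
  have "(\<Sum>a\<in>{1..m}. c a) = c i + (\<Sum>a\<in>{1..m}-{i}. c a)"
    "(\<Sum>a\<in>{1..m}. c' a) = c' i + (\<Sum>a\<in>{1..m}-{i}. c' a)"
    using i(1) by (auto intro: sum.remove)
  moreover have "(\<Sum>a\<in>{1..m}-{i}. c' a) = (\<Sum>a\<in>{1..m}-{i}. c a)"
    by (rule sum.cong) (auto simp: c'_def)
  ultimately have sum': "(\<Sum>a\<in>{1..m}. c' a) = card J'"
    using ipos Suc.prems(2) cJ by (simp add: c'_def)
  \<comment> \<open>The critical case is \<open>b = i\<close> with \<open>a\<close> different from
    \<open>i\<close>: there \<open>c a \<le> c i = c' i + 1\<close>, and \<open>1 \<le> D\<close>
    absorbs the loss.\<close>
  have bal': "c' a \<le> c' b + D" if "a \<in> {1..m}" "b \<in> {1..m}" for a b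
    using Suc.prems(4)[OF that] imax[OF that(1)] ipos Suc.prems(3) by (auto simp: c'_def)
  obtain f where f: "f ` J' \<subseteq> {1..m}" "\<And>a. a \<in> {1..m} \<Longrightarrow> card {j \<in> J'. f j = a} = c' a"
    "\<And>x a b. a \<in> {1..m} \<Longrightarrow> b \<in> {1..m} \<Longrightarrow>
        card {j \<in> J'. f j = a \<and> j \<le> x} \<le> card {j \<in> J'. f j = b \<and> j \<le> x} + D"
    using Suc.hyps(1)[of J' c'] Suc.hyps(2) cJ J(3) sum' Suc.prems(3) bal' by auto
  define h where "h = f(z := i)"
  have hf: "h j = f j" if "j \<in> J'" for j using that J(2) by (auto simp: h_def)
  have tot: "card {j \<in> J. h j = a} = c a" if "a \<in> {1..m}" for a
  proof (cases "a = i")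
    case True
    then have "{j \<in> J. h j = a} = insert z {j \<in> J'. f j = a}"
      using J(1) hf by (auto simp: h_def)
    then show ?thesis using f(2)[OF that] J True ipos by (simp add: c'_def)
  next
    case False
    then have "{j \<in> J. h j = a} = {j \<in> J'. f j = a}"
      using J(1,2) hf by (auto simp: h_def)
    then show ?thesis using f(2)[OF that] False by (simp add: c'_def)
  qed
  have "card {j \<in> J. h j = a \<and> j \<le> x} \<le> card {j \<in> J. h j = b \<and> j \<le> x} + D"
    if ab: "a \<in> {1..m}" "b \<in> {1..m}" for x a b
  \<comment> \<open>A prefix containing the largest job \<open>z\<close> is all of \<open>J\<close>;
    any other is a prefix of \<open>J'\<close>.\<close>
  proof (cases "z \<le> x")
    case True
    then have "{j \<in> J. h j = a \<and> j \<le> x} = {j \<in> J. h j = a}" for a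
      using J(1) z(2) by force
    then show ?thesis using tot ab Suc.prems(4) by simp
  next
    case False
    then have "{j \<in> J. h j = a \<and> j \<le> x} = {j \<in> J'. f j = a \<and> j \<le> x}" for a
      using J(1) hf by auto
    then show ?thesis using f(3) ab by simp
  qed
  moreover have "h ` J \<subseteq> {1..m}" using f(1) J(1) i(1) hf by (auto simp: h_def)
  ultimately show ?case using tot by blast
qed

section \<open>Assignments with prescribed type counts\<close>

definition job_type :: "nat \<Rightarrow> (nat \<Rightarrow> nat set) \<Rightarrow> nat \<Rightarrow> nat set" where
  "job_type K S j = {k \<in> {1..K}. j \<in> S k}"

text \<open>The cutoff \<open>j\<close> lets one notion serve for prefixes and, at
  \<open>j = n\<close>, for the total counts.\<close>

definition type_load ::
  "nat \<Rightarrow> nat \<Rightarrow> (nat \<Rightarrow> nat set) \<Rightarrow> (nat \<Rightarrow> nat) \<Rightarrow> nat \<Rightarrow> nat \<Rightarrow> nat set \<Rightarrow> nat" where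
  "type_load n K S \<phi> i j t = card {j' \<in> {1..n}. job_type K S j' = t \<and> \<phi> j' = i \<and> j' \<le> j}"

lemma sum_type_load:
  assumes "\<phi> \<in> assignments n m"
  shows "(\<Sum>a\<in>{1..m}. type_load n K S \<phi> a n t) = card {j \<in> {1..n}. job_type K S j = t}"
proof -
  have \<phi>: "\<phi> j \<in> {1..m}" if "j \<in> {1..n}" for j
    using assms that unfolding assignments_def by blast
  have "{j \<in> {1..n}. job_type K S j = t} =
      (\<Union>a\<in>{1..m}. {j' \<in> {1..n}. job_type K S j' = t \<and> \<phi> j' = a \<and> j' \<le> n})"
    using \<phi> by auto
  also have "card \<dots> = (\<Sum>a\<in>{1..m}. type_load n K S \<phi> a n t)"
    unfolding type_load_def by (rule card_UN_disjoint) auto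
  finally show ?thesis by simp
qed

text \<open>The jobs of scenario \<open>k\<close> are those whose type contains \<open>k\<close>, so
  splitting them by type carries bounds for single types over to prefix loads.\<close>

lemma prefix_load_eq_scenario_sum:
  assumes "k \<in> {1..K}"
  shows "prefix_load n S \<phi> k i j = scenario_sum K (type_load n K S \<phi> i j) k"
proof -
  have type: "job_type K S j' \<in> Pow {1..K}" "k \<in> job_type K S j' \<longleftrightarrow> j' \<in> S k" for j'
    using assms by (auto simp: job_type_def)
  have "{j' \<in> jobs_on n \<phi> i \<inter> S k. j' \<le> j} = (\<Union>t\<in>{t \<in> Pow {1..K}. k \<in> t}.
      {j' \<in> {1..n}. job_type K S j' = t \<and> \<phi> j' = i \<and> j' \<le> j})"
    using type by (fastforce simp: jobs_on_def)
  also have "card \<dots> = scenario_sum K (type_load n K S \<phi> i j) k"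
    unfolding scenario_sum_def type_load_def by (rule card_UN_disjoint) auto
  finally show ?thesis by (simp add: prefix_load_def)
qed

text \<open>The types partition the jobs, so \<open>balanced_distribution\<close> can be applied to
  each type separately and the results glued together.\<close>

lemma ex_assignment_type_load:
  assumes "1 \<le> D"
    and "\<And>t. t \<in> Pow {1..K} \<Longrightarrow> (\<Sum>a\<in>{1..m}. c a t) = card {j \<in> {1..n}. job_type K S j = t}"
    and "\<And>t a b. t \<in> Pow {1..K} \<Longrightarrow> a \<in> {1..m} \<Longrightarrow> b \<in> {1..m} \<Longrightarrow> c a t \<le> c b t + D"
  shows "\<exists>\<phi>\<in>assignments n m.
    (\<forall>a\<in>{1..m}. \<forall>t\<in>Pow {1..K}. type_load n K S \<phi> a n t = c a t) \<and>
    (\<forall>a\<in>{1..m}. \<forall>b\<in>{1..m}. \<forall>j. \<forall>t\<in>Pow {1..K}.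
       type_load n K S \<phi> a j t \<le> type_load n K S \<phi> b j t + D)"
proof -
  let ?J = "\<lambda>t. {j \<in> {1..n}. job_type K S j = t}"
  define P where "P t f \<longleftrightarrow> f ` ?J t \<subseteq> {1..m} \<and> (\<forall>a\<in>{1..m}. card {j \<in> ?J t. f j = a} = c a t) \<and>
     (\<forall>x. \<forall>a\<in>{1..m}. \<forall>b\<in>{1..m}.
        card {j \<in> ?J t. f j = a \<and> j \<le> x} \<le> card {j \<in> ?J t. f j = b \<and> j \<le> x} + D)" for t f
  have "\<forall>t\<in>Pow {1..K}. \<exists>f. P t f"
    unfolding P_def using assms by (intro ballI balanced_distribution) auto
  from bchoice[OF this] obtain f where f: "\<And>t. t \<in> Pow {1..K} \<Longrightarrow> P t (f t)" by blast
  define \<phi> where "\<phi> = (\<lambda>j\<in>{1..n}. f (job_type K S j) j)"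
  have type: "job_type K S j \<in> Pow {1..K}" for j by (auto simp: job_type_def)
  have load: "type_load n K S \<phi> a j t = card {j' \<in> ?J t. f t j' = a \<and> j' \<le> j}" for a j t
    unfolding type_load_def by (rule arg_cong[of _ _ card]) (auto simp: \<phi>_def)
  have full: "{j' \<in> ?J t. f t j' = a \<and> j' \<le> n} = {j' \<in> ?J t. f t j' = a}" for a t by auto
  show ?thesis
  proof (intro bexI[of _ \<phi>] conjI ballI allI)
    have "f (job_type K S j) j \<in> {1..m}" if "j \<in> {1..n}" for j
      using f[OF type, of j] that unfolding P_def by blast
    then show "\<phi> \<in> assignments n m" by (simp add: assignments_def \<phi>_def)
    show "type_load n K S \<phi> a n t = c a t" if "a \<in> {1..m}" "t \<in> Pow {1..K}" for a t
      unfolding load full using f[OF that(2)] that(1) unfolding P_def by blast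
    show "type_load n K S \<phi> a j t \<le> type_load n K S \<phi> b j t + D"
      if "a \<in> {1..m}" "b \<in> {1..m}" "t \<in> Pow {1..K}" for a b j t
      unfolding load using f[OF that(3)] that(1,2) unfolding P_def by blast
  qed
qed

section \<open>Exchanging jobs between two machines\<close>

lemma sum_card_prefixes:
  fixes X :: "nat set"
  assumes "finite X"
  shows "(\<Sum>j\<in>X. real (card {j' \<in> X. j' \<le> j})) = real (card X) * (real (card X) + 1) / 2"
  using assms
proof (induction rule: finite_linorder_max_induct)
  case (insert b X)
  have b: "b \<notin> X" using insert by blast
  have "{j' \<in> insert b X. j' \<le> j} = {j' \<in> X. j' \<le> j}" if "j \<in> X" for j
    using insert that by fastforce
  then have "(\<Sum>j\<in>X. real (card {j' \<in> insert b X. j' \<le> j})) = real (card X) * (real (card X) + 1) / 2"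
    using insert.IH by simp
  moreover have "{j' \<in> insert b X. j' \<le> b} = insert b X" using insert by force
  ultimately show ?case using insert.hyps(1) b by (simp add: field_simps)
qed simp

text \<open>A machine with \<open>L\<close> jobs of a scenario pays \<open>1 + ... + L\<close>, and
  \<open>L\<close> is a scenario sum of type counts. Assignments with equal type counts therefore
  have equal cost.\<close>

lemma total_cost_unit_weights:
  assumes "\<forall>j\<in>{1..n}. w j = 1"
  shows "total_cost n m K w S \<phi> = (\<Sum>k\<in>{1..K}. \<Sum>i\<in>{1..m}.
    real (scenario_sum K (type_load n K S \<phi> i n) k) *
    (real (scenario_sum K (type_load n K S \<phi> i n) k) + 1) / 2)"
  unfolding total_cost_def scenario_cost_def
proof (intro sum.cong refl)
  fix k i assume k: "k \<in> {1..K}"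
  let ?X = "jobs_on n \<phi> i \<inter> S k"
  have "finite ?X" by (auto simp: jobs_on_def)
  have "{j' \<in> ?X. j' \<le> n} = ?X" by (auto simp: jobs_on_def)
  then have "card ?X = scenario_sum K (type_load n K S \<phi> i n) k"
    using prefix_load_eq_scenario_sum[OF k, of n S \<phi> i n] by (simp add: prefix_load_def)
  moreover have "(\<Sum>j\<in>?X. w j * real (prefix_load n S \<phi> k i j)) =
      (\<Sum>j\<in>?X. real (card {j' \<in> ?X. j' \<le> j}))"
    using assms by (intro sum.cong) (auto simp: prefix_load_def jobs_on_def)
  ultimately show "(\<Sum>j\<in>?X. w j * real (prefix_load n S \<phi> k i j)) =
    real (scenario_sum K (type_load n K S \<phi> i n) k) *
    (real (scenario_sum K (type_load n K S \<phi> i n) k) + 1) / 2"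
    using sum_card_prefixes[OF \<open>finite ?X\<close>] by simp
qed

text \<open>A tie-breaker among optimal assignments: it also detects exchanges that alter type
  counts while leaving all scenario loads, and hence the cost, unchanged.\<close>

definition sq_potential :: "nat \<Rightarrow> nat \<Rightarrow> nat \<Rightarrow> (nat \<Rightarrow> nat set) \<Rightarrow> (nat \<Rightarrow> nat) \<Rightarrow> int" where
  "sq_potential n m K S \<phi> =
     (\<Sum>t\<in>Pow {1..K}. \<Sum>i\<in>{1..m}. (int (type_load n K S \<phi> i n t))\<^sup>2)"

lemma sum_two_changed:
  fixes F G :: "nat \<Rightarrow> 'a :: ab_group_add"
  assumes "p \<in> A" "q \<in> A" "p \<noteq> q" "finite A"
    and "\<And>a. a \<in> A \<Longrightarrow> a \<noteq> p \<Longrightarrow> a \<noteq> q \<Longrightarrow> F a = G a"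
  shows "sum F A = sum G A + (F p + F q - G p - G q)"
proof -
  have "sum H A = H p + (H q + sum H (A - {p} - {q}))" for H :: "nat \<Rightarrow> 'a"
    using assms by (simp add: sum.remove[of A p] sum.remove[of "A - {p}" q])
  moreover have "sum F (A - {p} - {q}) = sum G (A - {p} - {q})"
    by (rule sum.cong) (use assms in auto)
  ultimately show ?thesis by (simp add: algebra_simps)
qed


lemma int_scenario_sum:
  "int (scenario_sum K c k) = scenario_sum K (\<lambda>t. int (c t)) k"
  by (simp add: scenario_sum_def)

text \<open>If \<open>x\<close>, \<open>y\<close> have difference \<open>d\<close>, then \<open>y + e\<close>, \<open>x - e\<close> have the same sum and difference \<open>2 * e - d\<close>.\<close>

lemma exchange_sq_le:
  fixes x y e :: int
  assumes "between0 e (x - y)"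
  shows "(y + e)\<^sup>2 + (x - e)\<^sup>2 \<le> x\<^sup>2 + y\<^sup>2"
  using between0_reflect_sq_le[OF assms] by (simp add: power2_eq_square algebra_simps)

lemma exchange_sq_less:
  fixes x y e :: int
  assumes "between0 e (x - y)" "e \<noteq> x - y"
  shows "(y + e)\<^sup>2 + (x - e)\<^sup>2 < x\<^sup>2 + y\<^sup>2"
  using between0_reflect_sq_less[OF assms] by (simp add: power2_eq_square algebra_simps)

text \<open>The exchange preserves the sum of the two loads, so comparing triangular numbers reduces
  to comparing squares.\<close>

lemma triangular_exchange_le:
  fixes a b x y :: nat and e :: int
  assumes "between0 e (int x - int y)" "int a = int y + e" "int b = int x - e"
  shows "real a * (real a + 1) / 2 + real b * (real b + 1) / 2
    \<le> real x * (real x + 1) / 2 + real y * (real y + 1) / 2"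
proof -
  have "(int a)\<^sup>2 + (int b)\<^sup>2 \<le> (int x)\<^sup>2 + (int y)\<^sup>2"
    using exchange_sq_le[OF assms(1)] by (simp only: assms(2,3))
  then have "(real a)\<^sup>2 + (real b)\<^sup>2 \<le> (real x)\<^sup>2 + (real y)\<^sup>2"
    by (metis of_nat_add of_nat_le_iff of_nat_power)
  moreover have "real a + real b = real x + real y" using assms(2,3) by linarith
  ultimately show ?thesis by (simp add: power2_eq_square algebra_simps add_divide_distrib[symmetric])
qed

text \<open>A vector \<open>e\<close> violating irreducibility prescribes an exchange between
  \<open>p\<close> and \<open>q\<close> that keeps optimality but lowers the potential.\<close>

lemma optimal_diff_irreducible:
  assumes w: "\<forall>j\<in>{1..n}. w j = 1"
    and opt: "MinAvgSTC_optimal n m K w S \<phi>"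
    and pot: "\<And>\<psi>. MinAvgSTC_optimal n m K w S \<psi> \<Longrightarrow> sq_potential n m K S \<phi> \<le> sq_potential n m K S \<psi>"
    and p: "p \<in> {1..m}" and q: "q \<in> {1..m}"
  shows "irreducible_diff K (\<lambda>t. int (type_load n K S \<phi> p n t) - int (type_load n K S \<phi> q n t))"
proof (cases "p = q")
  case True
  \<comment> \<open>The difference vector is 0, and only 0 lies below 0.\<close>
  then show ?thesis by (auto simp: irreducible_diff_def between0_def)
next
  case False
  define x y where "x = type_load n K S \<phi> p n" and "y = type_load n K S \<phi> q n"
  have "e t = int (x t) - int (y t)"
    if e: "\<And>t. t \<in> Pow {1..K} \<Longrightarrow> between0 (e t) (int (x t) - int (y t))"
      and es: "\<And>k. k \<in> {1..K} \<Longrightarrow>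
        between0 (scenario_sum K e k) (scenario_sum K (\<lambda>t. int (x t) - int (y t)) k)"
      and t: "t \<in> Pow {1..K}" for e t
  proof (rule ccontr)
    assume ne: "e t \<noteq> int (x t) - int (y t)"
    \<comment> \<open>Machine \<open>p\<close> ends with \<open>y + e\<close> and \<open>q\<close>
      with \<open>x - e\<close>. Both values lie between \<open>x\<close> and \<open>y\<close>, so
      they are nonnegative and \<open>nat\<close> is exact.\<close>
    define c where "c = (\<lambda>a t. if a = p then nat (int (y t) + e t)
      else if a = q then nat (int (x t) - e t) else type_load n K S \<phi> a n t)"
    have cp: "int (c p t) = int (y t) + e t" and cq: "int (c q t) = int (x t) - e t"
      if "t \<in> Pow {1..K}" for t
      using e[OF that] False by (auto simp: c_def between0_def)
    have c_other: "c a t = type_load n K S \<phi> a n t" if "a \<noteq> p" "a \<noteq> q" for a t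
      using that by (simp add: c_def)
    \<comment> \<open>A crude constant above every count, which makes the balance condition
      immediate; only the type counts of \<open>\<psi>\<close> matter here.\<close>
    define D where "D = Suc (\<Sum>t\<in>Pow {1..K}. \<Sum>a\<in>{1..m}. c a t)"
    have total: "(\<Sum>a\<in>{1..m}. c a t) = card {j \<in> {1..n}. job_type K S j = t}"
      if "t \<in> Pow {1..K}" for t
    proof -
      have "(\<Sum>a\<in>{1..m}. int (c a t)) = (\<Sum>a\<in>{1..m}. int (type_load n K S \<phi> a n t))
        + (int (c p t) + int (c q t) - int (type_load n K S \<phi> p n t) - int (type_load n K S \<phi> q n t))"
        by (rule sum_two_changed) (use p q False c_other in auto)
      also have "\<dots> = int (\<Sum>a\<in>{1..m}. type_load n K S \<phi> a n t)"
        using cp[OF that] cq[OF that] by (simp add: x_def y_def)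
      finally show ?thesis
        using opt sum_type_load[of \<phi> n m K S t]
        by (simp only: MinAvgSTC_optimal_def of_nat_sum[symmetric] of_nat_eq_iff)
    qed
    have bal: "c a t \<le> c b t + D" if "t \<in> Pow {1..K}" "a \<in> {1..m}" "b \<in> {1..m}" for t a b
    proof -
      have "c a t \<le> (\<Sum>a\<in>{1..m}. c a t)" by (rule member_le_sum) (use that in auto)
      also have "\<dots> \<le> (\<Sum>t\<in>Pow {1..K}. \<Sum>a\<in>{1..m}. c a t)"
        by (rule member_le_sum) (use that in auto)
      finally show ?thesis by (simp add: D_def)
    qed
    have "\<exists>\<psi>\<in>assignments n m.
      (\<forall>a\<in>{1..m}. \<forall>t\<in>Pow {1..K}. type_load n K S \<psi> a n t = c a t) \<and>
      (\<forall>a\<in>{1..m}. \<forall>b\<in>{1..m}. \<forall>j. \<forall>t\<in>Pow {1..K}.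
        type_load n K S \<psi> a j t \<le> type_load n K S \<psi> b j t + D)"
      by (rule ex_assignment_type_load) (simp add: D_def, fact total, fact bal)
    then obtain \<psi> where \<psi>: "\<psi> \<in> assignments n m"
      "\<And>a t. a \<in> {1..m} \<Longrightarrow> t \<in> Pow {1..K} \<Longrightarrow> type_load n K S \<psi> a n t = c a t"
      by blast
    let ?L = "\<lambda>\<phi> a k. scenario_sum K (type_load n K S \<phi> a n) k"
    have L: "?L \<psi> a k = scenario_sum K (c a) k" if "a \<in> {1..m}" for a k
      unfolding scenario_sum_def by (rule sum.cong) (use \<psi>(2) that in auto)
    have "total_cost n m K w S \<psi> \<le> total_cost n m K w S \<phi>"
      unfolding total_cost_unit_weights[OF w]
    proof (rule sum_mono)
      fix k assume k: "k \<in> {1..K}"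
      let ?T = "\<lambda>\<phi> a. real (?L \<phi> a k) * (real (?L \<phi> a k) + 1) / 2"
      have "(\<Sum>a\<in>{1..m}. ?T \<psi> a) = (\<Sum>a\<in>{1..m}. ?T \<phi> a) + (?T \<psi> p + ?T \<psi> q - ?T \<phi> p - ?T \<phi> q)"
      proof (rule sum_two_changed)
        fix a assume a: "a \<in> {1..m}" "a \<noteq> p" "a \<noteq> q"
        then have "c a = type_load n K S \<phi> a n" using c_other by auto
        then show "?T \<psi> a = ?T \<phi> a" using L a(1) by simp
      qed (use p q False in auto)
      \<comment> \<open>By linearity the loads in scenario \<open>k\<close> undergo the same kind of
        exchange, with the scenario sum of \<open>e\<close> in place of \<open>e\<close>.\<close>
      moreover have "?T \<psi> p + ?T \<psi> q \<le> ?T \<phi> p + ?T \<phi> q"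
      proof (rule triangular_exchange_le)
        show "between0 (scenario_sum K e k) (int (?L \<phi> p k) - int (?L \<phi> q k))"
          using es[OF k] unfolding int_scenario_sum
          by (simp add: scenario_sum_def sum_subtractf x_def y_def)
        have "int (?L \<psi> p k) = (\<Sum>t\<in>{t \<in> Pow {1..K}. k \<in> t}. int (y t) + e t)"
          unfolding L[OF p] int_scenario_sum unfolding scenario_sum_def
          by (rule sum.cong) (use cp in auto)
        then show "int (?L \<psi> p k) = int (?L \<phi> q k) + scenario_sum K e k"
          by (simp add: scenario_sum_def sum.distrib y_def)
        have "int (?L \<psi> q k) = (\<Sum>t\<in>{t \<in> Pow {1..K}. k \<in> t}. int (x t) - e t)"
          unfolding L[OF q] int_scenario_sum unfolding scenario_sum_def
          by (rule sum.cong) (use cq in auto)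
        then show "int (?L \<psi> q k) = int (?L \<phi> p k) - scenario_sum K e k"
          by (simp add: scenario_sum_def sum_subtractf x_def)
      qed
      ultimately show "(\<Sum>a\<in>{1..m}. ?T \<psi> a) \<le> (\<Sum>a\<in>{1..m}. ?T \<phi> a)" by linarith
    qed
    then have "MinAvgSTC_optimal n m K w S \<psi>"
      using opt \<psi>(1) unfolding MinAvgSTC_optimal_def by (meson order_trans)
    moreover have "sq_potential n m K S \<psi> < sq_potential n m K S \<phi>"
      unfolding sq_potential_def
    proof (rule sum_strict_mono_ex1)
      let ?Q = "\<lambda>\<phi> t a. (int (type_load n K S \<phi> a n t))\<^sup>2"
      have eq: "(\<Sum>a\<in>{1..m}. ?Q \<psi> t a) = (\<Sum>a\<in>{1..m}. ?Q \<phi> t a)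
          + ((int (y t) + e t)\<^sup>2 + (int (x t) - e t)\<^sup>2 - (int (x t))\<^sup>2 - (int (y t))\<^sup>2)"
        if "t \<in> Pow {1..K}" for t
      proof -
        have "(\<Sum>a\<in>{1..m}. ?Q \<psi> t a) = (\<Sum>a\<in>{1..m}. ?Q \<phi> t a)
          + (?Q \<psi> t p + ?Q \<psi> t q - ?Q \<phi> t p - ?Q \<phi> t q)"
          by (rule sum_two_changed) (use p q False \<psi>(2) c_other that in auto)
        then show ?thesis
          by (simp only: \<psi>(2)[OF p that] \<psi>(2)[OF q that] cp[OF that] cq[OF that] x_def y_def)
      qed
      show "\<forall>t\<in>Pow {1..K}. (\<Sum>a\<in>{1..m}. ?Q \<psi> t a) \<le> (\<Sum>a\<in>{1..m}. ?Q \<phi> t a)"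
      proof
        fix t assume t: "t \<in> Pow {1..K}"
        show "(\<Sum>a\<in>{1..m}. ?Q \<psi> t a) \<le> (\<Sum>a\<in>{1..m}. ?Q \<phi> t a)"
          using eq[OF t] exchange_sq_le[OF e[OF t]] by linarith
      qed
      \<comment> \<open>The strict decrease occurs at the type \<open>t\<close> fixed by
        \<open>ne\<close>.\<close>
      show "\<exists>t\<in>Pow {1..K}. (\<Sum>a\<in>{1..m}. ?Q \<psi> t a) < (\<Sum>a\<in>{1..m}. ?Q \<phi> t a)"
        using eq[OF t] exchange_sq_less[OF e[OF t] ne] by (intro bexI[OF _ t]) linarith
    qed simp
    ultimately show False using pot by force
  qed
  then show ?thesis unfolding irreducible_diff_def x_def y_def by blast
qed

section \<open>Choice of the optimum and assembly of the bound\<close>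

text \<open>There are finitely many assignments, and at least one because \<open>1 \<le> m\<close>;
  minimise the cost first and then the potential over the minimisers.\<close>

lemma ex_optimal_min_sq_potential:
  assumes "stc_instance n m K S"
  obtains \<phi> where "MinAvgSTC_optimal n m K w S \<phi>"
    "\<And>\<psi>. MinAvgSTC_optimal n m K w S \<psi> \<Longrightarrow> sq_potential n m K S \<phi> \<le> sq_potential n m K S \<psi>"
proof -
  have fin: "finite (assignments n m)" "assignments n m \<noteq> {}"
    using assms by (auto simp: assignments_def stc_instance_def PiE_eq_empty_iff intro!: finite_PiE)
  let ?O = "{\<phi>. MinAvgSTC_optimal n m K w S \<phi>}"
  have "arg_min_on (total_cost n m K w S) (assignments n m) \<in> ?O"
    using arg_min_if_finite(1)[OF fin, of "total_cost n m K w S"]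
      arg_min_least[OF fin, of _ "total_cost n m K w S"] by (simp add: MinAvgSTC_optimal_def)
  moreover have "finite ?O"
    by (rule finite_subset[OF _ fin(1)]) (auto simp: MinAvgSTC_optimal_def)
  ultimately have O: "finite ?O" "?O \<noteq> {}" by blast+
  show thesis
    using that[of "arg_min_on (sq_potential n m K S) ?O"] arg_min_if_finite(1)[OF O] arg_min_least[OF O]
    by blast
qed

text \<open>Maximum and minimum are attained at machines, so comparing pairs of machines
  suffices.\<close>

lemma full_disbalance_le:
  assumes "1 \<le> m"
    and "\<And>j k a b. j \<in> {1..n} \<Longrightarrow> k \<in> {1..K} \<Longrightarrow> a \<in> {1..m} \<Longrightarrow> b \<in> {1..m} \<Longrightarrow>
      prefix_load n S \<phi> k a j \<le> prefix_load n S \<phi> k b j + B"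
  shows "full_disbalance n m K S \<phi> \<le> B"
  unfolding full_disbalance_def
proof (rule Max.boundedI)
  let ?P = "\<lambda>j k. {prefix_load n S \<phi> k i j | i. i \<in> {1..m}}"
  show "finite (insert 0 {Max (?P j k) - Min (?P j k) | j k. j \<in> {1..n} \<and> k \<in> {1..K}})"
    using finite_image_set2[of "\<lambda>j. j \<in> {1..n}" "\<lambda>k. k \<in> {1..K}"
        "\<lambda>j k. Max (?P j k) - Min (?P j k)"] by simp
  have "Max (?P j k) - Min (?P j k) \<le> B" if "j \<in> {1..n}" "k \<in> {1..K}" for j k
  proof -
    have P: "?P j k = (\<lambda>i. prefix_load n S \<phi> k i j) ` {1..m}" by auto
    have "finite (?P j k)" "?P j k \<noteq> {}" unfolding P using assms(1) by auto
    then have "Max (?P j k) \<in> ?P j k" "Min (?P j k) \<in> ?P j k" by (rule Max_in, rule Min_in)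
    then show ?thesis using assms(2)[OF that] by fastforce
  qed
  then show "x \<le> B" if "x \<in> insert 0 {Max (?P j k) - Min (?P j k) | j k. j \<in> {1..n} \<and> k \<in> {1..K}}" for x
    using that by blast
  show "insert 0 {Max (?P j k) - Min (?P j k) | j k. j \<in> {1..n} \<and> k \<in> {1..K}} \<noteq> {}"
    by (rule insert_not_empty)
qed

theorem theorem6:
  shows "\<exists>g :: nat \<Rightarrow> nat.
    \<forall>(n :: nat) (m :: nat) (K :: nat) (w :: nat \<Rightarrow> real) (S :: nat \<Rightarrow> nat set).
      stc_instance n m K S \<and> (\<forall>j\<in>{1..n}. w j = 1) \<longrightarrow>
      (\<exists>\<phi>. MinAvgSTC_optimal n m K w S \<phi> \<and> full_disbalance n m K S \<phi> \<le> g K)"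
proof -
  obtain D where D: "\<And>K d t. irreducible_diff K d \<Longrightarrow> t \<in> Pow {1..K} \<Longrightarrow> \<bar>d t\<bar> \<le> int (D K)"
    using irreducible_diff_bounded by metis
  \<comment> \<open>At most \<open>2 ^ K\<close> types contain a given scenario, and each
    contributes at most \<open>Suc (D K)\<close>; the successor secures the lower bound 1 required
    of the balance constant.\<close>
  have "\<exists>\<psi>. MinAvgSTC_optimal n m K w S \<psi> \<and> full_disbalance n m K S \<psi> \<le> 2 ^ K * Suc (D K)"
    if inst: "stc_instance n m K S" "\<forall>j\<in>{1..n}. w j = 1" for n m K w S
  proof -
    obtain \<phi> where opt: "MinAvgSTC_optimal n m K w S \<phi>"
      and pot: "\<And>\<psi>. MinAvgSTC_optimal n m K w S \<psi> \<Longrightarrow> sq_potential n m K S \<phi> \<le> sq_potential n m K S \<psi>"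
      using ex_optimal_min_sq_potential[OF inst(1)] by metis
    define c where "c = (\<lambda>a. type_load n K S \<phi> a n)"
    have total: "(\<Sum>a\<in>{1..m}. c a t) = card {j \<in> {1..n}. job_type K S j = t}" for t
      using opt sum_type_load by (simp add: c_def MinAvgSTC_optimal_def)
    have bal: "c a t \<le> c b t + Suc (D K)"
      if "t \<in> Pow {1..K}" "a \<in> {1..m}" "b \<in> {1..m}" for t a b
      using D[OF optimal_diff_irreducible[OF inst(2) opt pot that(2,3)] that(1)]
      unfolding c_def by linarith
    \<comment> \<open>Keeping the counts of \<open>\<phi>\<close> preserves the cost, while the
      order in which each type is handed out is chosen anew to balance all prefixes.\<close>
    have "\<exists>\<psi>\<in>assignments n m.
      (\<forall>a\<in>{1..m}. \<forall>t\<in>Pow {1..K}. type_load n K S \<psi> a n t = c a t) \<and>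
      (\<forall>a\<in>{1..m}. \<forall>b\<in>{1..m}. \<forall>j. \<forall>t\<in>Pow {1..K}.
        type_load n K S \<psi> a j t \<le> type_load n K S \<psi> b j t + Suc (D K))"
      by (rule ex_assignment_type_load) (simp, rule total, fact bal)
    then obtain \<psi> where \<psi>: "\<psi> \<in> assignments n m"
      "\<And>a t. a \<in> {1..m} \<Longrightarrow> t \<in> Pow {1..K} \<Longrightarrow> type_load n K S \<psi> a n t = c a t"
      "\<And>a b j t. a \<in> {1..m} \<Longrightarrow> b \<in> {1..m} \<Longrightarrow> t \<in> Pow {1..K} \<Longrightarrow>
        type_load n K S \<psi> a j t \<le> type_load n K S \<psi> b j t + Suc (D K)"
      by blast
    have "scenario_sum K (type_load n K S \<psi> a n) k = scenario_sum K (type_load n K S \<phi> a n) k"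
      if "a \<in> {1..m}" for a k
      unfolding scenario_sum_def by (rule sum.cong) (use \<psi>(2) that in \<open>auto simp: c_def\<close>)
    then have "total_cost n m K w S \<psi> = total_cost n m K w S \<phi>"
      unfolding total_cost_unit_weights[OF inst(2)] by simp
    then have "MinAvgSTC_optimal n m K w S \<psi>"
      using opt \<psi>(1) by (simp add: MinAvgSTC_optimal_def)
    moreover have "full_disbalance n m K S \<psi> \<le> 2 ^ K * Suc (D K)"
    proof (rule full_disbalance_le)
      show "1 \<le> m" using inst(1) by (simp add: stc_instance_def)
      fix j k a b assume k: "k \<in> {1..K}" and ab: "a \<in> {1..m}" "b \<in> {1..m}"
      let ?T = "{t \<in> Pow {1..K}. k \<in> t}"
      have "card ?T \<le> card (Pow {1..K})" by (rule card_mono) auto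
      then have card: "card ?T \<le> 2 ^ K" by (simp add: card_Pow)
      have "prefix_load n S \<psi> k a j \<le> (\<Sum>t\<in>?T. type_load n K S \<psi> b j t + Suc (D K))"
        unfolding prefix_load_eq_scenario_sum[OF k] scenario_sum_def
        by (rule sum_mono) (use \<psi>(3) ab in auto)
      also have "\<dots> = prefix_load n S \<psi> k b j + card ?T * Suc (D K)"
        unfolding prefix_load_eq_scenario_sum[OF k] scenario_sum_def
        by (simp only: sum.distrib sum_constant of_nat_id)
      also have "\<dots> \<le> prefix_load n S \<psi> k b j + 2 ^ K * Suc (D K)"
        by (intro add_left_mono mult_right_mono card) simp
      finally show "prefix_load n S \<psi> k a j \<le> prefix_load n S \<psi> k b j + 2 ^ K * Suc (D K)" .
    qed
    ultimately show ?thesis by blast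
  qed
  then show ?thesis by (intro exI[of _ "\<lambda>K. 2 ^ K * Suc (D K)"]) blast
qed

end
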